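(* Let $G=(V,E)$ be a finite simple undirected graph with at least one edge. Let $\mu_1$ be the largest eigenvalue of its adjacency matrix $A$, $\delta_1$ the largest eigenvalue of its signless Laplacian $Q=D+A$, and $\lambda_1$ the largest eigenvalue of its Laplacian $L=D-A$. Then $$1+\frac{\mu_1}{\mu_1-\delta_1+\lambda_1}\le\chi_v(G),$$ where $\chi_v(G)$ is the vector chromatic number of $G$.
   Context: $D$ denotes the diagonal matrix of vertex degrees of $G$. For a graph $G=(V,E)$ on $n$ vertices and a real number $k\ge 2$, a vector $k$-coloring of $G$ is an assignment of unit vectors $u_i\in\mathbb{R}^n$ to the vertices $i\in V$ such that $\langle u_i,u_j\rangle\le -\frac{1}{k-1}$ for every two adjacent vertices $i,j$. The vector chromatic number $\chi_v(G)$ is the smallest real number $k\ge 2$ for which a vector $k$-coloring of $G$ exists. *)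

theory Defs
  imports "HOL-Analysis.Analysis"
begin

text \<open>
  A finite simple undirected graph is given by its set E of two-element edges over a
  finite vertex type; the vertex set is the whole type, so \<^typ>\<open>real ^ 'v\<close>
  is the Euclidean space whose dimension is the number of vertices.
\<close>

definition simple_graph :: "'v::finite set set \<Rightarrow> bool" where
  "simple_graph E \<longleftrightarrow> (\<forall>e\<in>E. card e = 2)"

definition adjacent :: "'v::finite set set \<Rightarrow> 'v \<Rightarrow> 'v \<Rightarrow> bool" where
  "adjacent E i j \<longleftrightarrow> {i, j} \<in> E"

definition degree :: "'v::finite set set \<Rightarrow> 'v \<Rightarrow> nat" where
  "degree E i = card {j. adjacent E i j}"

definition adjacency_matrix :: "'v::finite set set \<Rightarrow> real ^ 'v ^ 'v" where
  "adjacency_matrix E = (\<chi> i j. if adjacent E i j then 1 else 0)"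

definition degree_matrix :: "'v::finite set set \<Rightarrow> real ^ 'v ^ 'v" where
  "degree_matrix E = (\<chi> i j. if i = j then real (degree E i) else 0)"

definition laplacian :: "'v::finite set set \<Rightarrow> real ^ 'v ^ 'v" where
  "laplacian E = degree_matrix E - adjacency_matrix E"

definition signless_laplacian :: "'v::finite set set \<Rightarrow> real ^ 'v ^ 'v" where
  "signless_laplacian E = degree_matrix E + adjacency_matrix E"

definition eigenvalue :: "real ^ 'v ^ 'v::finite \<Rightarrow> real \<Rightarrow> bool" where
  "eigenvalue M c \<longleftrightarrow> (\<exists>x. x \<noteq> 0 \<and> M *v x = c *\<^sub>R x)"

text \<open>
  Only applied to symmetric matrices, for which the set of real eigenvalues is finite and
  nonempty, so that \<^const>\<open>Max\<close> is meaningful.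
\<close>

definition largest_eigenvalue :: "real ^ 'v ^ 'v::finite \<Rightarrow> real" where
  "largest_eigenvalue M = Max {c. eigenvalue M c}"

definition vector_coloring :: "'v::finite set set \<Rightarrow> real \<Rightarrow> ('v \<Rightarrow> real ^ 'v) \<Rightarrow> bool" where
  "vector_coloring E k u \<longleftrightarrow>
     (\<forall>i. norm (u i) = 1) \<and> (\<forall>i j. adjacent E i j \<longrightarrow> u i \<bullet> u j \<le> - 1 / (k - 1))"

text \<open>
  The minimum is attained whenever there are at least two vertices: the vertices of a regular
  simplex give a vector coloring with k the number of vertices, and the admissible k form a
  closed set by compactness of the unit sphere.
\<close>

definition vector_chromatic_number :: "'v::finite set set \<Rightarrow> real" where
  "vector_chromatic_number E = (LEAST k. 2 \<le> k \<and> (\<exists>u. vector_coloring E k u))"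

end

theory Submission
  imports Defs
begin

text \<open>
  Let \<open>u\<close> be a vector \<open>k\<close>-coloring and \<open>y\<close> a nonnegative unit vector whose Rayleigh quotient
  with respect to \<open>Q\<close> is \<open>\<delta>\<^sub>1\<close>. The quadratic form of \<open>L\<close>, applied
  coordinatewise to the vectors \<open>y\<^sub>i u\<^sub>i\<close>, is at most \<open>\<lambda>\<^sub>1\<close>. As \<open>y \<ge> 0\<close>, the coloring condition
  bounds it from below by \<open>\<langle>y, D y\<rangle> + \<langle>y, A y\<rangle> / (k - 1)
  = \<langle>y, Q y\<rangle> - (1 - 1 / (k - 1)) \<langle>y, A y\<rangle> \<ge> \<delta>\<^sub>1 - (1 - 1 / (k - 1)) \<mu>\<^sub>1\<close>.
\<close>

section \<open>The largest eigenvalue of a symmetric matrix\<close>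

lemma inner_symmetric_matrix:
  fixes M :: "real ^ 'n ^ 'n::finite"
  assumes "transpose M = M"
  shows "x \<bullet> (M *v y) = (M *v x) \<bullet> y"
  by (metis assms dot_lmul_matrix transpose_matrix_vector)

lemma inner_matrix_vector_sum:
  fixes M :: "real ^ 'n ^ 'n::finite"
  shows "x \<bullet> (M *v x) = (\<Sum>i\<in>UNIV. \<Sum>j\<in>UNIV. M $ i $ j * (x $ i * x $ j))"
  by (simp add: inner_vec_def matrix_vector_mult_def sum_distrib_left ac_simps)

text \<open>Near \<open>t = 0\<close> the linear term dominates, so a nonzero \<open>a\<close> would
  make the expression negative on one side of 0. This stands in for the first-order condition at a
  maximizer.\<close>

lemma nonneg_quadratic_imp_linear_zero:
  fixes a b :: real
  assumes "\<And>t. 0 \<le> 2 * t * a + t\<^sup>2 * b" and "0 \<le> b"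
  shows "a = 0"
proof (rule ccontr)
  assume "a \<noteq> 0"
  \<comment> \<open>The vertex of the parabola is at \<open>- a / b\<close>; the shift to
    \<open>b + 1\<close> covers \<open>b = 0\<close> and still gives a negative value.\<close>
  define t where "t = - a / (b + 1)"
  have t: "a = - t * (b + 1)" and "t \<noteq> 0"
    using assms(2) \<open>a \<noteq> 0\<close> by (auto simp: t_def)
  have "2 * t * a + t\<^sup>2 * b = - (t\<^sup>2 * (b + 2))"
    by (simp add: t power2_eq_square algebra_simps)
  moreover have "0 < t\<^sup>2 * (b + 2)"
    using \<open>t \<noteq> 0\<close> assms(2) by simp
  ultimately show False using assms(1)[of t] by simp
qed

text \<open>The form of \<open>B = c I - M\<close> is positive semidefinite and vanishes at
  \<open>x\<close>. Moving \<open>x\<close> along \<open>B x\<close> gives a nonnegative quadratic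
  in \<open>t\<close> with linear coefficient \<open>2 * (B x \<bullet> B x)\<close>, which must
  therefore be 0.\<close>

lemma rayleigh_maximizer_is_eigenvector:
  fixes M :: "real ^ 'n ^ 'n::finite"
  assumes sym: "transpose M = M"
    and max: "\<And>y. y \<bullet> (M *v y) \<le> c * (y \<bullet> y)"
    and x: "x \<bullet> (M *v x) = c * (x \<bullet> x)"
  shows "M *v x = c *\<^sub>R x"
proof -
  define B where "B y = c *\<^sub>R y - M *v y" for y
  have nonneg: "0 \<le> y \<bullet> B y" for y
    using max[of y] by (simp add: B_def inner_diff_right)
  have "B x \<bullet> B x = 0"
  proof (rule nonneg_quadratic_imp_linear_zero)
    fix t
    have "(x + t *\<^sub>R B x) \<bullet> B (x + t *\<^sub>R B x) = 2 * t * (B x \<bullet> B x) + t\<^sup>2 * (B x \<bullet> B (B x))"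
    proof -
      have add: "B (y + t *\<^sub>R z) = B y + t *\<^sub>R B z" for y z
        by (simp add: B_def matrix_vector_right_distrib matrix_vector_mult_scaleR algebra_simps)
      have "x \<bullet> B x = 0"
        using x by (simp add: B_def inner_diff_right)
      moreover have "x \<bullet> B (B x) = B x \<bullet> B x"
        using inner_symmetric_matrix[OF sym, of x "B x"]
        by (subst (1 3) B_def) (simp add: inner_diff_left inner_diff_right)
      ultimately show ?thesis
        by (simp add: add inner_add_left inner_add_right power2_eq_square algebra_simps)
    qed
    then show "0 \<le> 2 * t * (B x \<bullet> B x) + t\<^sup>2 * (B x \<bullet> B (B x))"
      using nonneg[of "x + t *\<^sub>R B x"] by simp
  qed (rule nonneg)
  then show ?thesis by (simp add: B_def)
qed

text \<open>The form is continuous on the compact unit sphere, and its homogeneity of degree 2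
  carries the bound to all vectors.\<close>

lemma rayleigh_maximum_exists:
  fixes M :: "real ^ 'n ^ 'n::finite"
  obtains c x where "norm x = 1" "x \<bullet> (M *v x) = c"
    "\<And>y. y \<bullet> (M *v y) \<le> c * (y \<bullet> y)"
proof -
  have "continuous_on (sphere 0 1) (\<lambda>x. x \<bullet> (M *v x))"
    by (intro continuous_intros linear_continuous_on matrix_vector_mul_bounded_linear)
  moreover have "axis undefined 1 \<in> sphere (0 :: real ^ 'n) 1"
    by simp
  ultimately have "\<exists>x\<in>sphere 0 1. \<forall>y\<in>sphere 0 1. y \<bullet> (M *v y) \<le> x \<bullet> (M *v x)"
    by (intro continuous_attains_sup compact_sphere) auto
  then obtain x where x: "x \<in> sphere 0 1"
    and max: "\<And>y. y \<in> sphere 0 1 \<Longrightarrow> y \<bullet> (M *v y) \<le> x \<bullet> (M *v x)"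
    by blast
  have "y \<bullet> (M *v y) \<le> (x \<bullet> (M *v x)) * (y \<bullet> y)" for y
  proof (cases "y = 0")
    case False
    define z where "z = y /\<^sub>R norm y"
    have y: "y = norm y *\<^sub>R z" using False by (simp add: z_def)
    have "z \<bullet> (M *v z) \<le> x \<bullet> (M *v x)"
      using False by (intro max) (simp add: z_def)
    then have "(norm y)\<^sup>2 * (z \<bullet> (M *v z)) \<le> (norm y)\<^sup>2 * (x \<bullet> (M *v x))"
      by (intro mult_left_mono) auto
    moreover have "y \<bullet> (M *v y) = (norm y)\<^sup>2 * (z \<bullet> (M *v z))"
      by (subst (1 2) y) (simp add: matrix_vector_mult_scaleR power2_eq_square)
    ultimately show ?thesis by (simp add: power2_norm_eq_inner mult.commute)
  qed simp
  then show thesis using that x by simp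
qed

text \<open>Eigenvectors for distinct eigenvalues are orthogonal, and a pairwise orthogonal set in
  finite dimension is finite. This makes \<open>Max\<close> in \<open>largest_eigenvalue\<close>
  meaningful.\<close>

lemma finite_eigenvalues:
  fixes M :: "real ^ 'n ^ 'n::finite"
  assumes sym: "transpose M = M"
  shows "finite {c. eigenvalue M c}"
proof -
  define v where "v c = (SOME x. x \<noteq> 0 \<and> M *v x = c *\<^sub>R x)" for c
  have v: "v c \<noteq> 0" "M *v v c = c *\<^sub>R v c" if "eigenvalue M c" for c
    using someI_ex[of "\<lambda>x. x \<noteq> 0 \<and> M *v x = c *\<^sub>R x"] that
    by (auto simp: v_def eigenvalue_def)
  have orth: "v c \<bullet> v d = 0" if "eigenvalue M c" "eigenvalue M d" "c \<noteq> d" for c d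
    using inner_symmetric_matrix[OF sym, of "v c" "v d"] v that by simp
  have "inj_on v {c. eigenvalue M c}"
    using orth v by (intro inj_onI) (metis inner_eq_zero_iff mem_Collect_eq)
  moreover have "finite (v ` {c. eigenvalue M c})"
    by (rule pairwise_orthogonal_imp_finite)
      (auto simp: pairwise_def orthogonal_def intro!: orth)
  ultimately show ?thesis by (rule finite_imageD[rotated])
qed

text \<open>The maximum of the Rayleigh quotient is an eigenvalue, and testing the quotient on an
  eigenvector bounds every other eigenvalue by it.\<close>

lemma largest_eigenvalue_rayleigh:
  fixes M :: "real ^ 'n ^ 'n::finite"
  assumes sym: "transpose M = M"
  shows "y \<bullet> (M *v y) \<le> largest_eigenvalue M * (y \<bullet> y)"
    and "\<exists>x. norm x = 1 \<and> x \<bullet> (M *v x) = largest_eigenvalue M"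
proof -
  obtain c x where x: "norm x = 1" "x \<bullet> (M *v x) = c"
    and max: "\<And>y. y \<bullet> (M *v y) \<le> c * (y \<bullet> y)"
    using rayleigh_maximum_exists[of M] by blast
  have "M *v x = c *\<^sub>R x"
    using x by (intro rayleigh_maximizer_is_eigenvector[OF sym max]) (simp add: norm_eq_1)
  then have "eigenvalue M c"
    using x(1) unfolding eigenvalue_def by (intro exI[of _ x]) auto
  moreover have "d \<le> c" if d: "eigenvalue M d" for d
  proof -
    obtain z where z: "z \<noteq> 0" "M *v z = d *\<^sub>R z"
      using d unfolding eigenvalue_def by blast
    have "d * (z \<bullet> z) \<le> c * (z \<bullet> z)"
      using max[of z] z(2) by (simp only: inner_scaleR_right)
    then show ?thesis using z(1) by simp
  qed
  ultimately have c: "largest_eigenvalue M = c"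
    unfolding largest_eigenvalue_def by (intro Max_eqI finite_eigenvalues[OF sym]) auto
  show "y \<bullet> (M *v y) \<le> largest_eigenvalue M * (y \<bullet> y)"
    unfolding c by (rule max)
  show "\<exists>x. norm x = 1 \<and> x \<bullet> (M *v x) = largest_eigenvalue M"
    unfolding c by (intro exI conjI) (rule x)+
qed

text \<open>The form splits over the coordinates of the \<open>v i\<close>: for each
  \<open>t\<close>, the \<open>t\<close>-th coordinates form one ordinary vector \<open>w t\<close>,
  to which the scalar bound applies.\<close>

lemma largest_eigenvalue_vector_rayleigh:
  fixes M :: "real ^ 'n ^ 'n::finite" and v :: "'n \<Rightarrow> real ^ 'm::finite"
  assumes "transpose M = M"
  shows "(\<Sum>i\<in>UNIV. \<Sum>j\<in>UNIV. M $ i $ j * (v i \<bullet> v j)) \<le>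
    largest_eigenvalue M * (\<Sum>i\<in>UNIV. v i \<bullet> v i)"
proof -
  define w where "w t = (\<chi> i. v i $ t)" for t
  have "(\<Sum>i\<in>UNIV. \<Sum>j\<in>UNIV. M $ i $ j * (v i \<bullet> v j)) =
      (\<Sum>i\<in>UNIV. \<Sum>j\<in>UNIV. \<Sum>t\<in>UNIV. M $ i $ j * (v i $ t * v j $ t))"
    by (simp add: inner_vec_def sum_distrib_left)
  also have "\<dots> = (\<Sum>i\<in>UNIV. \<Sum>t\<in>UNIV. \<Sum>j\<in>UNIV. M $ i $ j * (v i $ t * v j $ t))"
    by (intro sum.cong refl sum.swap)
  also have "\<dots> = (\<Sum>t\<in>UNIV. \<Sum>i\<in>UNIV. \<Sum>j\<in>UNIV. M $ i $ j * (v i $ t * v j $ t))"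
    by (rule sum.swap)
  also have "\<dots> = (\<Sum>t\<in>UNIV. w t \<bullet> (M *v w t))"
    by (simp add: inner_matrix_vector_sum w_def)
  also have "\<dots> \<le> (\<Sum>t\<in>UNIV. largest_eigenvalue M * (w t \<bullet> w t))"
    by (intro sum_mono largest_eigenvalue_rayleigh(1) assms)
  also have "\<dots> = largest_eigenvalue M * (\<Sum>t\<in>UNIV. \<Sum>i\<in>UNIV. v i $ t * v i $ t)"
    by (simp add: w_def inner_vec_def sum_distrib_left)
  also have "(\<Sum>t\<in>UNIV. \<Sum>i\<in>UNIV. v i $ t * v i $ t) = (\<Sum>i\<in>UNIV. v i \<bullet> v i)"
    unfolding inner_vec_def by (subst sum.swap) simp
  finally show ?thesis .
qed

section \<open>Matrices of a graph\<close>

lemma adjacent_sym: "adjacent E i j \<longleftrightarrow> adjacent E j i"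
  by (simp add: adjacent_def insert_commute)

lemma adjacent_irrefl: "simple_graph E \<Longrightarrow> \<not> adjacent E i i"
  by (auto simp: adjacent_def simple_graph_def)

lemma simple_graph_edge:
  assumes "simple_graph E" "E \<noteq> {}"
  obtains i j where "adjacent E i j" "i \<noteq> j"
  using assms by (metis adjacent_def all_not_in_conv card_2_iff simple_graph_def)

lemma transpose_graph_matrices:
  "transpose (adjacency_matrix E) = adjacency_matrix E"
  "transpose (laplacian E) = laplacian E"
  "transpose (signless_laplacian E) = signless_laplacian E"
  by (auto simp: transpose_def vec_eq_iff adjacency_matrix_def degree_matrix_def laplacian_def
      signless_laplacian_def adjacent_sym)

text \<open>The all-ones vector is a test vector: its form has no negative terms, and an edge
  contributes a positive one.\<close>

lemma adjacency_largest_eigenvalue_pos: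
  assumes "simple_graph E" "E \<noteq> {}"
  shows "0 < largest_eigenvalue (adjacency_matrix E)"
proof -
  obtain a b where ab: "adjacent E a b" "a \<noteq> b"
    using simple_graph_edge[OF assms] by blast
  define x :: "real ^ 'a" where "x = 1"
  let ?A = "adjacency_matrix E"
  have "0 < (\<Sum>j\<in>UNIV. ?A $ a $ j * (x $ a * x $ j))"
    by (rule sum_pos2[of _ b]) (use ab in \<open>auto simp: x_def adjacency_matrix_def\<close>)
  then have "0 < (\<Sum>i\<in>UNIV. \<Sum>j\<in>UNIV. ?A $ i $ j * (x $ i * x $ j))"
    by (rule sum_pos2[rotated 2]) (auto intro!: sum_nonneg simp: x_def adjacency_matrix_def)
  also have "\<dots> = x \<bullet> (?A *v x)"
    by (simp only: inner_matrix_vector_sum)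
  also have "\<dots> \<le> largest_eigenvalue ?A * (x \<bullet> x)"
    by (intro largest_eigenvalue_rayleigh transpose_graph_matrices)
  finally show ?thesis
    by (metis inner_ge_zero mult_le_0_iff not_le)
qed

text \<open>All entries of \<open>Q\<close> are nonnegative, so taking absolute values in a
  maximizer preserves its norm and does not decrease the form.\<close>

lemma signless_laplacian_nonneg_maximizer:
  obtains y where "norm y = 1" "\<And>i. 0 \<le> y $ i"
    "y \<bullet> (signless_laplacian E *v y) \<ge> largest_eigenvalue (signless_laplacian E)"
proof -
  let ?Q = "signless_laplacian E"
  obtain x where x: "norm x = 1" "x \<bullet> (?Q *v x) = largest_eigenvalue ?Q"
    using largest_eigenvalue_rayleigh(2)[OF transpose_graph_matrices(3)] by blast
  define y where "y = (\<chi> i. \<bar>x $ i\<bar>)"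
  have "norm y = 1"
    using x(1) by (simp add: y_def norm_vec_def)
  moreover have "x \<bullet> (?Q *v x) \<le> y \<bullet> (?Q *v y)"
    unfolding inner_matrix_vector_sum
  proof (intro sum_mono mult_left_mono)
    fix i j
    show "x $ i * x $ j \<le> y $ i * y $ j"
      by (simp add: y_def flip: abs_mult)
    show "0 \<le> ?Q $ i $ j"
      by (simp add: signless_laplacian_def degree_matrix_def adjacency_matrix_def)
  qed
  ultimately show thesis
    using that[of y] x(2) by (simp add: y_def)
qed

section \<open>Vector colorings\<close>

lemma vector_coloring_bound:
  assumes E: "simple_graph E" and k: "2 \<le> k" and u: "vector_coloring E k u"
  shows "largest_eigenvalue (adjacency_matrix E) / (k - 1) \<le>
    largest_eigenvalue (adjacency_matrix E) - largest_eigenvalue (signless_laplacian E)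
      + largest_eigenvalue (laplacian E)"
proof -
  let ?A = "adjacency_matrix E" and ?Q = "signless_laplacian E" and ?L = "laplacian E"
  obtain y where y: "norm y = 1" "\<And>i. 0 \<le> y $ i"
    and yQ: "largest_eigenvalue ?Q \<le> y \<bullet> (?Q *v y)"
    using signless_laplacian_nonneg_maximizer[of E] by blast
  have nu: "u i \<bullet> u i = 1" for i
    using u by (simp add: vector_coloring_def norm_eq_1)
  \<comment> \<open>With this \<open>s\<close>, the entry of \<open>Q - s A\<close> at an edge is
    \<open>1 / (k - 1)\<close>, the value the coloring condition supplies. Its nonnegativity, from
    \<open>2 \<le> k\<close>, lets an upper bound on the form of \<open>A\<close> be used
    below.\<close>
  define s where "s = 1 - 1 / (k - 1)"
  have s: "0 \<le> s" using k by (simp add: s_def)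
  have "y \<bullet> (?Q *v y) - s * (y \<bullet> (?A *v y)) =
      (\<Sum>i\<in>UNIV. \<Sum>j\<in>UNIV. (?Q $ i $ j - s * ?A $ i $ j) * (y $ i * y $ j))"
    unfolding inner_matrix_vector_sum
    by (simp add: sum_distrib_left sum_subtractf algebra_simps)
  also have "\<dots> \<le> (\<Sum>i\<in>UNIV. \<Sum>j\<in>UNIV. ?L $ i $ j * ((y $ i *\<^sub>R u i) \<bullet> (y $ j *\<^sub>R u j)))"
  proof (intro sum_mono)
    fix i j
    show "(?Q $ i $ j - s * ?A $ i $ j) * (y $ i * y $ j)
      \<le> ?L $ i $ j * ((y $ i *\<^sub>R u i) \<bullet> (y $ j *\<^sub>R u j))"
    proof (cases "adjacent E i j")
      case True
      then have "i \<noteq> j" using E adjacent_irrefl by blast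
      \<comment> \<open>The entry of \<open>L\<close> here is -1, so this upper bound becomes a
        lower bound for the term of \<open>L\<close>.\<close>
      have "u i \<bullet> u j \<le> - 1 / (k - 1)"
        using u True by (simp add: vector_coloring_def)
      then have "(y $ i * y $ j) * (u i \<bullet> u j) \<le> (y $ i * y $ j) * (- 1 / (k - 1))"
        by (intro mult_left_mono mult_nonneg_nonneg y(2))
      then show ?thesis
        using True \<open>i \<noteq> j\<close>
        by (simp add: signless_laplacian_def laplacian_def adjacency_matrix_def
            degree_matrix_def s_def ac_simps)
    next
      \<comment> \<open>Only the degree matrix contributes, and since \<open>u i\<close> is a unit
        vector both sides agree, on the diagonal as well.\<close>
      case False
      then show ?thesis
        by (simp add: signless_laplacian_def laplacian_def adjacency_matrix_def
            degree_matrix_def nu)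
    qed
  qed
  also have "\<dots> \<le> largest_eigenvalue ?L * (\<Sum>i\<in>UNIV. (y $ i *\<^sub>R u i) \<bullet> (y $ i *\<^sub>R u i))"
    by (intro largest_eigenvalue_vector_rayleigh transpose_graph_matrices)
  also have "(\<Sum>i\<in>UNIV. (y $ i *\<^sub>R u i) \<bullet> (y $ i *\<^sub>R u i)) = y \<bullet> y"
    by (simp only: inner_scaleR_left inner_scaleR_right nu) (simp add: inner_vec_def)
  finally have "y \<bullet> (?Q *v y) - s * (y \<bullet> (?A *v y)) \<le> largest_eigenvalue ?L"
    using y(1) by (simp add: norm_eq_1)
  moreover have "s * (y \<bullet> (?A *v y)) \<le> s * largest_eigenvalue ?A"
    using largest_eigenvalue_rayleigh(1)[OF transpose_graph_matrices(1), of y E] y(1) s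
    by (intro mult_left_mono) (auto simp: norm_eq_1)
  ultimately have "largest_eigenvalue ?Q - s * largest_eigenvalue ?A \<le> largest_eigenvalue ?L"
    using yQ by linarith
  then show ?thesis
    by (simp add: s_def algebra_simps)
qed

section \<open>Existence of an optimal vector coloring\<close>

lemma simplex_vector_coloring:
  fixes E :: "'v::finite set set"
  assumes E: "simple_graph E" and n: "2 \<le> CARD('v)"
  shows "\<exists>u. vector_coloring E (real CARD('v)) u"
proof -
  define n where "n = real CARD('v)"
  have n2: "2 \<le> n" using n by (simp add: n_def)
  \<comment> \<open>Each standard basis vector is shifted by the centroid of all of them. The result
    has squared length \<open>(n - 1) / n\<close>, which the scalar factor normalizes.\<close>
  define u :: "'v \<Rightarrow> real ^ 'v" where
    "u i = sqrt (n / (n - 1)) *\<^sub>R (axis i 1 - (1 / n) *\<^sub>R 1)" for i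
  have one: "(1 :: real ^ 'v) \<bullet> 1 = n"
    by (simp add: inner_vec_def n_def)
  have inner: "u i \<bullet> u j = n / (n - 1) * ((if i = j then 1 else 0) - 1 / n)" for i j
  proof -
    have "u i \<bullet> u j = (sqrt (n / (n - 1)))\<^sup>2 *
        ((axis i 1 - (1 / n) *\<^sub>R 1) \<bullet> (axis j 1 - (1 / n) *\<^sub>R (1 :: real ^ 'v)))"
      by (simp only: u_def inner_scaleR_left inner_scaleR_right power2_eq_square mult.assoc)
    also have "(sqrt (n / (n - 1)))\<^sup>2 = n / (n - 1)"
      using n2 by simp
    also have "(axis i 1 - (1 / n) *\<^sub>R 1) \<bullet> (axis j 1 - (1 / n) *\<^sub>R (1 :: real ^ 'v)) =
        (if i = j then 1 else 0) - 1 / n"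
      using n2 by (simp add: inner_diff_left inner_diff_right inner_axis inner_axis' one)
        (simp add: axis_def)
    finally show ?thesis .
  qed
  have "vector_coloring E n u"
    unfolding vector_coloring_def
  proof (intro conjI allI impI)
    fix i
    show "norm (u i) = 1"
      using n2 by (simp add: norm_eq_1 inner field_simps)
  next
    fix i j
    assume "adjacent E i j"
    then have "i \<noteq> j" using E adjacent_irrefl by blast
    then show "u i \<bullet> u j \<le> - 1 / (n - 1)"
      using n2 by (simp add: inner)
  qed
  then show ?thesis by (auto simp: n_def)
qed

text \<open>\<open>LEAST\<close> over the reals says something only once a minimum exists. It is
  found by minimizing the first component over a compact set of pairs of a number and a coloring;
  the simplex shows that set to be nonempty.\<close>

lemma vector_chromatic_number_attained:
  fixes E :: "'v::finite set set"
  assumes E: "simple_graph E" and n: "2 \<le> CARD('v)"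
  shows "2 \<le> vector_chromatic_number E \<and> (\<exists>u. vector_coloring E (vector_chromatic_number E) u)"
proof -
  define n where "n = real CARD('v)"
  \<comment> \<open>Colorings are stored as the rows of a matrix, so that \<open>K\<close> lies in a
    Euclidean space. Clearing the positive denominator \<open>k - 1\<close> leaves a condition
    continuous in both components, hence a closed set.\<close>
  define K :: "(real \<times> (real ^ 'v ^ 'v)) set" where
    "K = {p. fst p \<in> {2..n} \<and> (\<forall>i. norm (snd p $ i) = 1) \<and>
      (\<forall>i j. adjacent E i j \<longrightarrow> (fst p - 1) * (snd p $ i \<bullet> snd p $ j) \<le> - 1)}"
  have K_iff: "(k, U) \<in> K \<longleftrightarrow> k \<in> {2..n} \<and> vector_coloring E k (($) U)" for k U
  proof -
    have "x \<le> - 1 / (k - 1) \<longleftrightarrow> (k - 1) * x \<le> - 1" if "2 \<le> k" for x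
      using that by (subst pos_le_divide_eq) (auto simp: mult.commute)
    then show ?thesis
      unfolding K_def vector_coloring_def by auto
  qed
  have "bounded K"
  proof (rule bounded_subset)
    show "bounded ({2..n} \<times> cball (0 :: real ^ 'v ^ 'v) n)"
      by (intro bounded_Times) auto
    show "K \<subseteq> {2..n} \<times> cball 0 n"
    proof
      fix p assume p: "p \<in> K"
      have "norm (snd p) \<le> (\<Sum>i\<in>UNIV. norm (snd p $ i))"
        unfolding norm_vec_def by (intro L2_set_le_sum) simp
      also have "\<dots> = n" using p by (simp add: K_def n_def)
      finally show "p \<in> {2..n} \<times> cball 0 n"
        using p by (auto simp: K_def mem_Times_iff)
    qed
  qed
  moreover have "closed K"
    unfolding K_def atLeastAtMost_iff
    by (intro closed_Collect_conj closed_Collect_all closed_Collect_imp closed_Collect_le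
        closed_Collect_eq continuous_intros open_Collect_const)
  ultimately have "compact K"
    by (simp add: compact_eq_bounded_closed)
  moreover have coloring_mem: "(k, \<chi> i. u i) \<in> K" if "vector_coloring E k u" "2 \<le> k" "k \<le> n" for k u
  proof -
    have "($) (\<chi> i. u i) = u" by auto
    then show ?thesis using that by (simp add: K_iff)
  qed
  then have "K \<noteq> {}"
    using simplex_vector_coloring[OF assms] n by (fastforce simp: n_def)
  ultimately obtain p where p: "p \<in> K" "\<And>q. q \<in> K \<Longrightarrow> fst p \<le> fst q"
    using continuous_attains_inf[of K fst] continuous_on_fst[OF continuous_on_id] by meson
  obtain k U where kU: "p = (k, U)" by (cases p)
  have "vector_chromatic_number E = k"
    unfolding vector_chromatic_number_def
  proof (rule Least_equality)
    show "2 \<le> k \<and> (\<exists>u. vector_coloring E k u)"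
      using p(1) by (auto simp: kU K_iff)
    fix l
    assume l: "2 \<le> l \<and> (\<exists>u. vector_coloring E l u)"
    show "k \<le> l"
    proof (cases "l \<le> n")
      case True
      then show ?thesis using l coloring_mem p(2) kU by fastforce
    next
      \<comment> \<open>The cap at \<open>n\<close> loses nothing: the minimizer satisfies
        \<open>k \<le> n < l\<close>.\<close>
      case False
      then show ?thesis using p(1) by (simp add: kU K_iff)
    qed
  qed
  then show ?thesis using p(1) by (auto simp: kU K_iff)
qed

theorem theorem4:
  fixes E :: "'v::finite set set"
    and mu1 delta1 lambda1 :: real
  assumes "simple_graph E"
    and "E \<noteq> {}"
    and "mu1 = largest_eigenvalue (adjacency_matrix E)"
    and "delta1 = largest_eigenvalue (signless_laplacian E)"
    and "lambda1 = largest_eigenvalue (laplacian E)"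
  shows "1 + mu1 / (mu1 - delta1 + lambda1) \<le> vector_chromatic_number E"
proof -
  obtain a b :: 'v where "a \<noteq> b"
    by (rule simple_graph_edge[OF assms(1,2)])
  then have "2 \<le> CARD('v)"
    using card_mono[of UNIV "{a, b}"] by simp
  then obtain u where k: "2 \<le> vector_chromatic_number E"
    and u: "vector_coloring E (vector_chromatic_number E) u"
    using vector_chromatic_number_attained[OF assms(1)] by blast
  have mu: "0 < mu1"
    using adjacency_largest_eigenvalue_pos[OF assms(1,2)] assms(3) by simp
  have bound: "mu1 / (vector_chromatic_number E - 1) \<le> mu1 - delta1 + lambda1"
    using vector_coloring_bound[OF assms(1) k u] assms(3-5) by simp
  moreover have "0 < mu1 / (vector_chromatic_number E - 1)"
    using mu k by simp
  \<comment> \<open>Positivity of the denominator is a consequence of the bound itself; it allows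
    \<open>k - 1\<close> and the denominator to be exchanged.\<close>
  ultimately have "0 < mu1 - delta1 + lambda1" by linarith
  with bound show ?thesis
    using k by (simp add: field_simps)
qed

end
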